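(* There exists a universal constant $C>0$ such that the following holds. Let $k\ge2$, $d\ge1$, let $\mu$ and $\nu$ be probability distributions supported on a set $\{x_1,\dots,x_k\}\subseteq\mathbb R^d$, and let $\delta=\min_{i\ne j}\|x_i-x_j\|$. Then $$\mathcal E_1^2(\mu,\nu)\ge\frac{C\,\delta}{k\sqrt d}\;\mathsf{TV}^2(\mu,\nu).$$
   Context: $\|\cdot\|$ is the Euclidean norm. $\mathsf{TV}(\mu,\nu)=\sup_{A}[\mu(A)-\nu(A)]$. The energy distance is given by $\mathcal E_1^2(\mu,\nu)=\mathbb E\big[2\|X-Y\|-\|X-X'\|-\|Y-Y'\|\big]$ with $(X,X',Y,Y')\sim\mu^{\otimes2}\otimes\nu^{\otimes2}$. *)

theory Defs
  imports "HOL-Probability.Probability"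
begin

(* The constant in the result must be uniform in the dimension, so the dimension has to be
   a number quantified inside the statement rather than a type. A point of R^d is
   an extensional function on {..<d}, and R^d carries the product Borel sigma-algebra,
   which is its Borel sigma-algebra. *)
definition Rn :: "nat \<Rightarrow> (nat \<Rightarrow> real) measure" where
  "Rn d = (\<Pi>\<^sub>M i\<in>{..<d}. borel)"

definition eucl_dist :: "nat \<Rightarrow> (nat \<Rightarrow> real) \<Rightarrow> (nat \<Rightarrow> real) \<Rightarrow> real" where
  "eucl_dist d x y = L2_set (\<lambda>i. x i - y i) {..<d}"

definition prob_on_Rn :: "nat \<Rightarrow> (nat \<Rightarrow> real) measure \<Rightarrow> bool" where
  "prob_on_Rn d \<mu> \<longleftrightarrow> prob_space \<mu> \<and> sets \<mu> = sets (Rn d)"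

definition supported_on :: "'a measure \<Rightarrow> 'a set \<Rightarrow> bool" where
  "supported_on \<mu> S \<longleftrightarrow> (AE x in \<mu>. x \<in> S)"

(* Intended for probability measures with sets \<mu> = sets \<nu>. *)
definition TV :: "'a measure \<Rightarrow> 'a measure \<Rightarrow> real" where
  "TV \<mu> \<nu> = (SUP A\<in>sets \<mu>. measure \<mu> A - measure \<nu> A)"

(* This is the squared quantity, not its square root. *)
definition energy_dist_sq ::
    "nat \<Rightarrow> (nat \<Rightarrow> real) measure \<Rightarrow> (nat \<Rightarrow> real) measure \<Rightarrow> real" where
  "energy_dist_sq d \<mu> \<nu> =
     (\<integral>(X, X', Y, Y'). 2 * eucl_dist d X Y - eucl_dist d X X' - eucl_dist d Y Y'
        \<partial>(\<mu> \<Otimes>\<^sub>M \<mu> \<Otimes>\<^sub>M \<nu> \<Otimes>\<^sub>M \<nu>))"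

(* The points need not be distinct: a repetition makes the separation 0. *)
definition min_separation :: "nat \<Rightarrow> nat \<Rightarrow> (nat \<Rightarrow> nat \<Rightarrow> real) \<Rightarrow> real" where
  "min_separation d k x =
     Min {eucl_dist d (x i) (x j) | i j. i \<in> {1..k} \<and> j \<in> {1..k} \<and> i \<noteq> j}"

end

theory Submission
  imports Defs
begin

text \<open>With weights \<open>w\<^sub>p = \<mu>{p} - \<nu>{p}\<close> of total mass \<open>0\<close>, the energy distance is
  \<open>- \<Sum> w\<^sub>p w\<^sub>q |p - q|\<close>. Up to a constant factor, \<open>r\<close> is the integral of
  \<open>(1 - exp (- t\<^sup>2 r\<^sup>2)) / t\<^sup>2\<close> over \<open>t\<close>, so the energy distance is a positive mixture of the
  Gaussian forms \<open>\<Sum> w\<^sub>p w\<^sub>q exp (- t\<^sup>2 |p - q|\<^sup>2)\<close>, which are nonnegative. When \<open>t\<close> is at least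
  of order \<open>sqrt d / \<delta>\<close>, the Gaussian matrix is diagonally dominant and its form is at least
  \<open>\<Sum> w\<^sub>p\<^sup>2 / 2\<close>; the total weight of these \<open>t\<close> is of order \<open>\<delta> / sqrt d\<close>. Cauchy--Schwarz
  then gives \<open>TV\<^sup>2 \<le> (\<Sum> |w\<^sub>p|)\<^sup>2 \<le> k \<Sum> w\<^sub>p\<^sup>2\<close>.\<close>

subsection \<open>Positivity of the Gaussian kernel\<close>

lemma eucl_dist_sq: "(eucl_dist d x y)\<^sup>2 = (\<Sum>l<d. (x l - y l)\<^sup>2)"
  by (simp add: eucl_dist_def L2_set_def sum_nonneg)

lemma eucl_dist_nonneg: "0 \<le> eucl_dist d x y"
  by (simp add: eucl_dist_def)

lemma eucl_dist_commute: "eucl_dist d x y = eucl_dist d y x"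
  by (simp add: eucl_dist_def L2_set_def power2_commute)

lemma eucl_dist_self [simp]: "eucl_dist d x x = 0"
  by (simp add: eucl_dist_def L2_set_def)

text \<open>Induction on the exponent, for all weights at once: one factor of the inner product is
  expanded over the coordinates, and \<open>p l\<close> and \<open>q l\<close> are absorbed into the
  weights, which leaves a sum of forms with the smaller exponent. At exponent \<open>0\<close> the
  form is a square.\<close>

lemma gram_power_psd:
  fixes S :: "(nat \<Rightarrow> real) set"
  shows "0 \<le> (\<Sum>p\<in>S. \<Sum>q\<in>S. w p * w q * (\<Sum>l<d. p l * q l) ^ n)"
proof (induction n arbitrary: w)
  case 0
  have "(\<Sum>p\<in>S. \<Sum>q\<in>S. w p * w q) = (\<Sum>p\<in>S. w p)\<^sup>2"
    by (simp add: power2_eq_square sum_product)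
  then show ?case by simp
next
  case (Suc n)
  have "(\<Sum>p\<in>S. \<Sum>q\<in>S. w p * w q * (\<Sum>l<d. p l * q l) ^ Suc n)
      = (\<Sum>p\<in>S. \<Sum>q\<in>S. \<Sum>l<d. (w p * p l) * (w q * q l) * (\<Sum>l<d. p l * q l) ^ n)"
    by (intro sum.cong refl) (simp add: sum_distrib_left sum_distrib_right mult_ac)
  also have "\<dots> = (\<Sum>l<d. \<Sum>p\<in>S. \<Sum>q\<in>S. (w p * p l) * (w q * q l) * (\<Sum>l<d. p l * q l) ^ n)"
    by (simp add: sum.swap[of _ "{..<d}"])
  also have "\<dots> \<ge> 0"
    by (intro sum_nonneg Suc.IH)
  finally show ?case .
qed

text \<open>The power series of \<open>exp\<close> has nonnegative coefficients, so the form is a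
  convergent sum of nonnegative multiples of the power forms.\<close>

lemma exp_gram_psd:
  fixes S :: "(nat \<Rightarrow> real) set"
  assumes "0 \<le> c"
  shows "0 \<le> (\<Sum>p\<in>S. \<Sum>q\<in>S. w p * w q * exp (c * (\<Sum>l<d. p l * q l)))"
proof -
  have "(\<lambda>n. \<Sum>p\<in>S. \<Sum>q\<in>S. w p * w q * ((c * (\<Sum>l<d. p l * q l)) ^ n /\<^sub>R fact n)) sums
        (\<Sum>p\<in>S. \<Sum>q\<in>S. w p * w q * exp (c * (\<Sum>l<d. p l * q l)))"
    by (intro sums_sum sums_mult exp_converges)
  moreover have "(\<Sum>p\<in>S. \<Sum>q\<in>S. w p * w q * ((c * (\<Sum>l<d. p l * q l)) ^ n /\<^sub>R fact n))
      = c ^ n / fact n * (\<Sum>p\<in>S. \<Sum>q\<in>S. w p * w q * (\<Sum>l<d. p l * q l) ^ n)" for n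
    unfolding sum_distrib_left[of "c ^ n / fact n"] power_mult_distrib
    by (intro sum.cong refl) (simp add: divide_inverse mult_ac)
  ultimately have "(\<lambda>n. c ^ n / fact n * (\<Sum>p\<in>S. \<Sum>q\<in>S. w p * w q * (\<Sum>l<d. p l * q l) ^ n)) sums
        (\<Sum>p\<in>S. \<Sum>q\<in>S. w p * w q * exp (c * (\<Sum>l<d. p l * q l)))"
    by simp
  from sums_le[OF _ sums_zero this] show ?thesis
    using assms by (simp add: gram_power_psd)
qed

text \<open>Expanding the squared distance splits the Gaussian into a factor in \<open>p\<close>, a
  factor in \<open>q\<close>, and an exponential of the inner product. The first two factors only
  change the weights.\<close>

lemma gauss_kernel_psd:
  fixes S :: "(nat \<Rightarrow> real) set"
  shows "0 \<le> (\<Sum>p\<in>S. \<Sum>q\<in>S. w p * w q * exp (- (t\<^sup>2 * (eucl_dist d p q)\<^sup>2)))"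
proof -
  define u where "u p = w p * exp (- (t\<^sup>2 * (\<Sum>l<d. (p l)\<^sup>2)))" for p
  have "w p * w q * exp (- (t\<^sup>2 * (eucl_dist d p q)\<^sup>2))
      = u p * u q * exp (2 * t\<^sup>2 * (\<Sum>l<d. p l * q l))" for p q
  proof -
    have "(eucl_dist d p q)\<^sup>2 = (\<Sum>l<d. (p l)\<^sup>2) + (\<Sum>l<d. (q l)\<^sup>2) - 2 * (\<Sum>l<d. p l * q l)"
      unfolding eucl_dist_sq
      by (simp add: power2_diff sum.distrib sum_subtractf sum_distrib_left mult.assoc)
    then have "- (t\<^sup>2 * (eucl_dist d p q)\<^sup>2) = - (t\<^sup>2 * (\<Sum>l<d. (p l)\<^sup>2)) + - (t\<^sup>2 * (\<Sum>l<d. (q l)\<^sup>2))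
        + 2 * t\<^sup>2 * (\<Sum>l<d. p l * q l)"
      by (simp only:) (simp add: algebra_simps)
    then show ?thesis
      unfolding u_def by (simp only: exp_add mult_ac)
  qed
  then show ?thesis
    using exp_gram_psd[of "2 * t\<^sup>2" u d S] by simp
qed

subsection \<open>Diagonal dominance for separated points\<close>

text \<open>The point is the bound \<open>3\<close>, uniform in \<open>M\<close>, for the lattice
  sum along one coordinate.\<close>

lemma sum_half_power_abs:
  "(\<Sum>n\<in>{- int M..int M}. (1/2) ^ nat \<bar>n\<bar>) = 3 - 2 * (1/2::real) ^ M"
proof (induction M)
  case (Suc M)
  have "{- int (Suc M)..int (Suc M)} = insert (- int (Suc M)) (insert (int (Suc M)) {- int M..int M})"
    by auto
  then show ?case
    using Suc by (simp add: nat_add_distrib)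
qed simp

text \<open>Points are rounded to a cubic grid with a corner at \<open>p\<close>. Distinct points
  lie in distinct cells, and each Gaussian term is at most a product over the coordinates of the
  cell index. Summing over all cells of a box gives the \<open>d\<close>-th power of a
  one-dimensional sum below \<open>1\<close>, so the bound depends neither on the number of points
  nor on \<open>d\<close>.\<close>

lemma gauss_row_sum_le_half:
  fixes S :: "(nat \<Rightarrow> real) set"
  assumes S: "finite S" "p \<in> S" and d: "1 \<le> d" and \<delta>: "0 < \<delta>" "5 * d \<le> t\<^sup>2 * \<delta>\<^sup>2"
    and sep: "\<And>q q'. q \<in> S \<Longrightarrow> q' \<in> S \<Longrightarrow> q \<noteq> q' \<Longrightarrow> \<delta> \<le> eucl_dist d q q'"
  shows "(\<Sum>q\<in>S - {p}. exp (- (t\<^sup>2 * (eucl_dist d p q)\<^sup>2))) \<le> 1/2"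
proof -
  define s where "s = \<delta> / sqrt d"
  have s: "0 < s" "s\<^sup>2 * d = \<delta>\<^sup>2"
    using d \<delta> by (auto simp: s_def power_divide)
  have ts: "5 \<le> t\<^sup>2 * s\<^sup>2"
    using \<delta>(2) d by (simp add: s(2)[symmetric] mult.assoc[symmetric])
  define N where "N q = (\<lambda>l\<in>{..<d}. \<lfloor>(q l - p l) / s\<rfloor>)" for q
  \<comment> \<open>The cubes of side \<open>s\<close> have diameter \<open>\<delta>\<close>, so each contains at most one point of \<open>S\<close>.\<close>
  have inj: "inj_on N S"
  proof (rule inj_onI, rule ccontr)
    fix q q' assume q: "q \<in> S" "q' \<in> S" "N q = N q'" "q \<noteq> q'"
    have "(q l - q' l)\<^sup>2 < s\<^sup>2" if "l < d" for l
    proof -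
      have "\<lfloor>(q l - p l) / s\<rfloor> = \<lfloor>(q' l - p l) / s\<rfloor>"
        using q(3) that by (auto simp: N_def fun_eq_iff restrict_def split: if_splits)
      then have "\<bar>(q l - p l) / s - (q' l - p l) / s\<bar> < 1"
        by linarith
      then have "\<bar>q l - q' l\<bar> < s"
        using s(1) by (simp add: diff_divide_distrib[symmetric] abs_divide)
      then show ?thesis
        using s(1) by (metis abs_ge_zero power2_abs power_strict_mono zero_less_numeral)
    qed
    then have "(eucl_dist d q q')\<^sup>2 < (\<Sum>l<d. s\<^sup>2)"
      unfolding eucl_dist_sq using d by (intro sum_strict_mono) (auto simp: lessThan_empty_iff)
    also have "\<dots> = \<delta>\<^sup>2"
      using s(2) by (simp add: mult.commute)
    finally have "eucl_dist d q q' < \<delta>"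
      using \<delta>(1) by (simp add: power_less_imp_less_base)
    with sep q show False by force
  qed
  \<comment> \<open>The factor \<open>1/8\<close> outweighs the lattice sum, which is at most
    \<open>3\<close>; otherwise the \<open>d\<close>-th power would grow with the dimension.\<close>
  define g where "g n = 1/8 * (1/2::real) ^ nat \<bar>n\<bar>" for n
  have term_le: "exp (- (t\<^sup>2 * (eucl_dist d p q)\<^sup>2)) \<le> (\<Prod>l<d. g (N q l))" if q: "q \<in> S - {p}" for q
  proof -
    define y where "y l = (q l - p l) / s" for l
    have D: "(eucl_dist d p q)\<^sup>2 = s\<^sup>2 * (\<Sum>l<d. (y l)\<^sup>2)"
      unfolding eucl_dist_commute[of d p] eucl_dist_sq y_def
      using s(1) by (simp add: sum_distrib_left power_divide)
    have "\<delta>\<^sup>2 \<le> (eucl_dist d p q)\<^sup>2"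
      using sep[of p q] q S \<delta>(1) by (intro power_mono) auto
    then have "s\<^sup>2 * d \<le> s\<^sup>2 * (\<Sum>l<d. (y l)\<^sup>2)"
      by (simp only: D s(2))
    then have y_ge: "d \<le> (\<Sum>l<d. (y l)\<^sup>2)"
      using s(1) by simp
    \<comment> \<open>Rounding down increases the absolute value by at most \<open>1\<close>; beyond
      \<open>1\<close> the square dominates the absolute value.\<close>
    have y_floor: "real_of_int \<bar>\<lfloor>v\<rfloor>\<bar> - 1 \<le> v\<^sup>2" for v :: real
    proof (cases "\<bar>v\<bar> \<le> 1")
      case True
      then have "\<bar>\<lfloor>v\<rfloor>\<bar> \<le> 1" by linarith
      then have "real_of_int \<bar>\<lfloor>v\<rfloor>\<bar> \<le> 1" by linarith
      then show ?thesis using zero_le_power2[of v] by linarith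
    next
      case False
      have "real_of_int \<bar>\<lfloor>v\<rfloor>\<bar> - 1 \<le> \<bar>v\<bar>" by linarith
      also have "\<dots> \<le> \<bar>v\<bar>\<^sup>2"
        using False by (intro self_le_power) auto
      finally show ?thesis by simp
    qed
    \<comment> \<open>This is the origin of the constant \<open>5\<close>. Four copies of the sum of
      squares pay for \<open>4 * d\<close>: three units per coordinate become the factor
      \<open>1/8\<close> of \<open>g\<close>, and one covers the rounding. The fifth copy pays for
      the cell index.\<close>
    have "real (\<Sum>l<d. 3 + nat \<bar>N q l\<bar>) = 4 * d + (\<Sum>l<d. real_of_int \<bar>\<lfloor>y l\<rfloor>\<bar> - 1)"
      by (simp add: N_def y_def sum.distrib sum_subtractf)
    also have "\<dots> \<le> 4 * (\<Sum>l<d. (y l)\<^sup>2) + (\<Sum>l<d. (y l)\<^sup>2)"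
      using y_ge by (intro add_mono sum_mono y_floor) auto
    also have "\<dots> = 5 * (\<Sum>l<d. (y l)\<^sup>2)"
      by simp
    also have "\<dots> \<le> t\<^sup>2 * s\<^sup>2 * (\<Sum>l<d. (y l)\<^sup>2)"
      using ts by (intro mult_right_mono sum_nonneg) auto
    also have "\<dots> = t\<^sup>2 * (eucl_dist d p q)\<^sup>2"
      by (simp add: D)
    finally have "exp (- (t\<^sup>2 * (eucl_dist d p q)\<^sup>2)) \<le> exp (- real (\<Sum>l<d. 3 + nat \<bar>N q l\<bar>))"
      by simp
    also have "\<dots> = exp (- 1) ^ (\<Sum>l<d. 3 + nat \<bar>N q l\<bar>)"
      by (subst exp_of_nat_mult[symmetric]) simp
    also have "\<dots> \<le> (1/2) ^ (\<Sum>l<d. 3 + nat \<bar>N q l\<bar>)"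
    proof (rule power_mono)
      have "2 \<le> exp (1::real)" using exp_ge_add_one_self[of 1] by simp
      then show "exp (- 1) \<le> (1/2::real)" by (simp add: exp_minus field_simps)
    qed simp
    also have "\<dots> = (\<Prod>l<d. g (N q l))"
      by (simp add: power_sum g_def power_add power_divide)
    finally show ?thesis .
  qed
  \<comment> \<open>All cell indices of points of \<open>S\<close> lie in the box of integers of
    absolute value at most \<open>M\<close>. Over the whole box the sum of products
    factorizes.\<close>
  define B where "B = (\<Union>q\<in>S. \<Union>l<d. {nat \<bar>N q l\<bar>})"
  define M where "M = Max (insert 0 B)"
  have "finite B" using S by (auto simp: B_def)
  then have M: "nat \<bar>N q l\<bar> \<le> M" if "q \<in> S" "l < d" for q l
    unfolding M_def using that by (intro Max_ge) (auto simp: B_def)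
  have "(\<Sum>q\<in>S - {p}. exp (- (t\<^sup>2 * (eucl_dist d p q)\<^sup>2))) \<le> (\<Sum>q\<in>S - {p}. \<Prod>l<d. g (N q l))"
    by (intro sum_mono term_le)
  also have "\<dots> = (\<Sum>n\<in>N ` (S - {p}). \<Prod>l<d. g (n l))"
    using inj_on_subset[OF inj] by (subst sum.reindex) auto
  also have "\<dots> \<le> (\<Sum>n\<in>{..<d} \<rightarrow>\<^sub>E {- int M..int M}. \<Prod>l<d. g (n l))"
  proof (rule sum_mono2)
    show "finite ({..<d} \<rightarrow>\<^sub>E {- int M..int M})"
      by (simp add: finite_PiE)
    have "N q l \<in> {- int M..int M}" if "q \<in> S" "l < d" for q l
      using M[OF that] by auto
    then show "N ` (S - {p}) \<subseteq> {..<d} \<rightarrow>\<^sub>E {- int M..int M}"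
      by (auto simp: N_def PiE_def)
  qed (auto simp: g_def intro!: prod_nonneg)
  also have "\<dots> = (\<Prod>l<d. \<Sum>n\<in>{- int M..int M}. g n)"
    by (rule prod_sum_PiE[symmetric]) auto
  also have "\<dots> \<le> (3/8) ^ d"
  proof -
    have "(\<Sum>n\<in>{- int M..int M}. g n) = 1/8 * (3 - 2 * (1/2) ^ M)"
      unfolding g_def sum_distrib_left[symmetric] sum_half_power_abs ..
    then have "(\<Sum>n\<in>{- int M..int M}. g n) \<le> 3/8" by simp
    moreover have "0 \<le> (\<Sum>n\<in>{- int M..int M}. g n)"
      by (intro sum_nonneg) (simp add: g_def)
    ultimately show ?thesis by (simp add: power_mono)
  qed
  also have "\<dots> \<le> (3/8) ^ 1"
    using d by (intro power_decreasing) auto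
  finally show ?thesis by simp
qed

text \<open>Diagonal entries are \<open>1\<close>. Each off-diagonal term is bounded by the mean of
  two squares, and the row sums of at most \<open>1/2\<close> let these terms consume at most half
  of the diagonal.\<close>

lemma gauss_form_ge_half:
  fixes S :: "(nat \<Rightarrow> real) set"
  assumes S: "finite S" and d: "1 \<le> d" and \<delta>: "0 < \<delta>" "5 * d \<le> t\<^sup>2 * \<delta>\<^sup>2"
    and sep: "\<And>q q'. q \<in> S \<Longrightarrow> q' \<in> S \<Longrightarrow> q \<noteq> q' \<Longrightarrow> \<delta> \<le> eucl_dist d q q'"
  shows "1/2 * (\<Sum>p\<in>S. (w p)\<^sup>2) \<le> (\<Sum>p\<in>S. \<Sum>q\<in>S. w p * w q * exp (- (t\<^sup>2 * (eucl_dist d p q)\<^sup>2)))"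
proof -
  define g where "g p q = exp (- (t\<^sup>2 * (eucl_dist d p q)\<^sup>2))" for p q
  define O' where "O' = (SIGMA p:S. S - {p})"
  \<comment> \<open>By symmetry of the kernel, both squares in the mean lead to the same row
    sums.\<close>
  have sym: "(\<Sum>p\<in>S. \<Sum>q\<in>S - {p}. (w q)\<^sup>2 * g p q) = (\<Sum>p\<in>S. \<Sum>q\<in>S - {p}. (w p)\<^sup>2 * g p q)"
  proof -
    have "(\<Sum>p\<in>S. \<Sum>q\<in>S - {p}. (w q)\<^sup>2 * g p q) = (\<Sum>(p, q)\<in>O'. (w q)\<^sup>2 * g p q)"
      unfolding O'_def using S by (subst sum.Sigma) auto
    also have "\<dots> = (\<Sum>(p, q)\<in>O'. (w p)\<^sup>2 * g p q)"
      by (rule sum.reindex_bij_witness[of _ prod.swap prod.swap])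
        (auto simp: O'_def g_def eucl_dist_commute)
    also have "\<dots> = (\<Sum>p\<in>S. \<Sum>q\<in>S - {p}. (w p)\<^sup>2 * g p q)"
      unfolding O'_def using S by (subst sum.Sigma) auto
    finally show ?thesis .
  qed
  have "- (\<Sum>p\<in>S. \<Sum>q\<in>S - {p}. w p * w q * g p q)
      \<le> (\<Sum>p\<in>S. \<Sum>q\<in>S - {p}. 1/2 * ((w p)\<^sup>2 * g p q) + 1/2 * ((w q)\<^sup>2 * g p q))"
    unfolding sum_negf[symmetric]
  proof (intro sum_mono)
    fix p q
    have "0 \<le> 1/2 * (w p + w q)\<^sup>2 * g p q" by (simp add: g_def)
    then show "- (w p * w q * g p q) \<le> 1/2 * ((w p)\<^sup>2 * g p q) + 1/2 * ((w q)\<^sup>2 * g p q)"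
      by (simp add: power2_sum algebra_simps)
  qed
  also have "\<dots> = (\<Sum>p\<in>S. (w p)\<^sup>2 * (\<Sum>q\<in>S - {p}. g p q))"
    unfolding sum.distrib sum_distrib_left[symmetric] sym by simp
  also have "\<dots> \<le> (\<Sum>p\<in>S. (w p)\<^sup>2 * (1/2))"
    unfolding g_def using assms by (intro sum_mono mult_left_mono gauss_row_sum_le_half) auto
  finally have off: "- (\<Sum>p\<in>S. \<Sum>q\<in>S - {p}. w p * w q * g p q) \<le> 1/2 * (\<Sum>p\<in>S. (w p)\<^sup>2)"
    by (simp add: sum_distrib_left mult.commute)
  have "(\<Sum>p\<in>S. \<Sum>q\<in>S. w p * w q * g p q) = (\<Sum>p\<in>S. (w p)\<^sup>2 + (\<Sum>q\<in>S - {p}. w p * w q * g p q))"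
    using S by (intro sum.cong refl) (simp add: sum.remove g_def power2_eq_square)
  also have "\<dots> = (\<Sum>p\<in>S. (w p)\<^sup>2) + (\<Sum>p\<in>S. \<Sum>q\<in>S - {p}. w p * w q * g p q)"
    by (rule sum.distrib)
  finally show ?thesis
    using off by (simp add: g_def)
qed

subsection \<open>The distance as a mixture of Gaussians\<close>

text \<open>The value is \<open>2 * sqrt pi\<close>, by integration by parts; below only finiteness
  and positivity matter. At \<open>t = 0\<close> the integrand is \<open>0\<close> by the convention
  for division.\<close>

definition gauss_const :: real where
  "gauss_const = (\<integral>t. (1 - exp (- (t\<^sup>2))) / t\<^sup>2 \<partial>lborel)"

lemma integrable_gauss_const: "integrable lborel (\<lambda>t::real. (1 - exp (- (t\<^sup>2))) / t\<^sup>2)"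
proof (rule Bochner_Integration.integrable_bound)
  show "integrable lborel (\<lambda>t::real. 2 * inverse (1 + t\<^sup>2))"
    using integrable_inverse_1_plus_square by (simp add: set_integrable_def)
  \<comment> \<open>With \<open>v\<close> standing for the square of \<open>t\<close>: for
    \<open>v\<close> up to \<open>1\<close> the numerator is at most \<open>v\<close>, and beyond
    that it is at most \<open>1\<close>.\<close>
  have "(1 - exp (- v)) / v \<le> 2 * inverse (1 + v)" if "0 \<le> v" for v :: real
  proof (cases "v = 0")
    case False
    then have v: "0 < v" using that by simp
    have "(1 - exp (- v)) * (1 + v) \<le> 2 * v"
    proof (cases "v \<le> 1")
      case True
      have "(1 - exp (- v)) * (1 + v) \<le> v * 2"
        using True v exp_ge_add_one_self[of "- v"] by (intro mult_mono) auto
      then show ?thesis by simp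
    next
      case False
      have "(1 - exp (- v)) * (1 + v) \<le> 1 * (1 + v)"
        using v by (intro mult_right_mono) auto
      also have "\<dots> \<le> 2 * v" using False by simp
      finally show ?thesis .
    qed
    then show ?thesis using v by (simp add: field_simps)
  qed simp
  from this[of "t\<^sup>2" for t]
  show "AE t in lborel. norm ((1 - exp (- (t\<^sup>2))) / t\<^sup>2) \<le> norm (2 * inverse (1 + t\<^sup>2) :: real)"
    by (intro AE_I2) (simp add: abs_mult abs_divide)
qed simp

lemma gauss_const_pos: "0 < gauss_const"
proof -
  have "0 < (1 - exp (- 1)) / (4::real)" by simp
  also have "\<dots> = (\<integral>t. indicator {1..2::real} t * ((1 - exp (- 1)) / 4) \<partial>lborel)"
    by simp
  also have "\<dots> \<le> gauss_const"
    unfolding gauss_const_def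
  proof (rule integral_mono[OF _ integrable_gauss_const])
    show "integrable lborel (\<lambda>t. indicator {1..2::real} t * ((1 - exp (- 1)) / (4::real)))"
      by (intro integrable_mult_left) (auto simp: integrable_indicator_iff)
    show "indicator {1..2} t * ((1 - exp (- 1)) / 4) \<le> (1 - exp (- (t\<^sup>2))) / t\<^sup>2" for t :: real
    proof (cases "t \<in> {1..2}")
      case True
      then have "1 \<le> t\<^sup>2" "t\<^sup>2 \<le> 2\<^sup>2"
        using power_mono[of t 2 2] by (auto intro: one_le_power)
      then have "(1 - exp (- 1)) / 4 \<le> (1 - exp (- (t\<^sup>2))) / t\<^sup>2"
        by (intro frac_le) auto
      then show ?thesis using True by simp
    qed simp
  qed
  finally show ?thesis .
qed

text \<open>Substituting \<open>r * t\<close> for \<open>t\<close> produces the factor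
  \<open>r\<close> by homogeneity: the square of \<open>r\<close> from the integrand, divided by
  \<open>r\<close> from Lebesgue measure.\<close>

lemma has_bochner_integral_gauss_dist:
  assumes "0 \<le> r"
  shows "has_bochner_integral lborel (\<lambda>t. (1 - exp (- (t\<^sup>2 * r\<^sup>2))) / t\<^sup>2) (r * gauss_const)"
proof (cases "r = 0")
  case False
  then have r: "0 < r" using assms by simp
  have *: "(1 - exp (- (t\<^sup>2 * r\<^sup>2))) / t\<^sup>2 = r\<^sup>2 * ((1 - exp (- ((0 + r * t)\<^sup>2))) / (0 + r * t)\<^sup>2)" for t
    using r by (cases "t = 0") (auto simp: power_mult_distrib mult.commute)
  have "has_bochner_integral lborel (\<lambda>t. (1 - exp (- ((0 + r * t)\<^sup>2))) / (0 + r * t)\<^sup>2)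
      (gauss_const /\<^sub>R \<bar>r\<bar>)"
    using r integrable_gauss_const unfolding gauss_const_def
    by (subst lborel_has_bochner_integral_real_affine_iff[symmetric]) (auto intro: has_bochner_integral_integrable)
  from has_bochner_integral_mult_right[OF this, of "r\<^sup>2"] show ?thesis
    unfolding * using r by (simp add: power2_eq_square field_simps)
qed (simp add: has_bochner_integral_zero)

text \<open>Since the weights have total mass \<open>0\<close>, the constant \<open>1\<close> in the representation of
  the distance drops out, and only the positive definite Gaussian part remains.\<close>

lemma has_bochner_integral_energy_form:
  fixes S :: "(nat \<Rightarrow> real) set"
  assumes "(\<Sum>p\<in>S. w p) = 0"
  shows "has_bochner_integral lborel
     (\<lambda>t. (\<Sum>p\<in>S. \<Sum>q\<in>S. w p * w q * exp (- (t\<^sup>2 * (eucl_dist d p q)\<^sup>2))) / t\<^sup>2)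
     (gauss_const * - (\<Sum>p\<in>S. \<Sum>q\<in>S. w p * w q * eucl_dist d p q))"
proof -
  have w0: "(\<Sum>p\<in>S. \<Sum>q\<in>S. w p * w q) = 0"
    using assms by (simp add: sum_product[symmetric])
  have "has_bochner_integral lborel
     (\<lambda>t. \<Sum>p\<in>S. \<Sum>q\<in>S. - (w p * w q) * ((1 - exp (- (t\<^sup>2 * (eucl_dist d p q)\<^sup>2))) / t\<^sup>2))
     (\<Sum>p\<in>S. \<Sum>q\<in>S. - (w p * w q) * (eucl_dist d p q * gauss_const))"
    by (intro has_bochner_integral_sum has_bochner_integral_mult_right
        has_bochner_integral_gauss_dist eucl_dist_nonneg)
  moreover have "(\<Sum>p\<in>S. \<Sum>q\<in>S. - (w p * w q) * ((1 - exp (- (t\<^sup>2 * (eucl_dist d p q)\<^sup>2))) / t\<^sup>2))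
     = (\<Sum>p\<in>S. \<Sum>q\<in>S. w p * w q * exp (- (t\<^sup>2 * (eucl_dist d p q)\<^sup>2))) / t\<^sup>2" for t
  proof -
    have "(\<Sum>p\<in>S. \<Sum>q\<in>S. - (w p * w q) * ((1 - exp (- (t\<^sup>2 * (eucl_dist d p q)\<^sup>2))) / t\<^sup>2))
       = (\<Sum>p\<in>S. \<Sum>q\<in>S. w p * w q * exp (- (t\<^sup>2 * (eucl_dist d p q)\<^sup>2)) - w p * w q) / t\<^sup>2"
      unfolding sum_divide_distrib
      by (intro sum.cong refl) (simp add: algebra_simps diff_divide_distrib)
    then show ?thesis by (simp add: sum_subtractf w0)
  qed
  moreover have "(\<Sum>p\<in>S. \<Sum>q\<in>S. - (w p * w q) * (eucl_dist d p q * gauss_const))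
     = gauss_const * - (\<Sum>p\<in>S. \<Sum>q\<in>S. w p * w q * eucl_dist d p q)"
    by (simp add: sum_distrib_left sum_negf mult_ac)
  ultimately show ?thesis by simp
qed

text \<open>The mixture has a nonnegative integrand. No separation is assumed, so this also serves
  when some of the listed points coincide.\<close>

lemma energy_form_nonneg:
  fixes S :: "(nat \<Rightarrow> real) set"
  assumes "(\<Sum>p\<in>S. w p) = 0"
  shows "0 \<le> - (\<Sum>p\<in>S. \<Sum>q\<in>S. w p * w q * eucl_dist d p q)"
proof -
  have "0 \<le> gauss_const * - (\<Sum>p\<in>S. \<Sum>q\<in>S. w p * w q * eucl_dist d p q)"
    unfolding has_bochner_integral_integral_eq[OF has_bochner_integral_energy_form[OF assms], symmetric]
    by (intro Bochner_Integration.integral_nonneg divide_nonneg_nonneg gauss_kernel_psd) auto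
  then show ?thesis
    using gauss_const_pos by (simp only: zero_le_mult_iff) linarith
qed

text \<open>The integrand is nonnegative everywhere, so it suffices to integrate over a window of
  large \<open>t\<close> on which diagonal dominance holds.\<close>

lemma energy_form_ge:
  fixes S :: "(nat \<Rightarrow> real) set"
  assumes S: "finite S" and d: "1 \<le> d" and \<delta>: "0 < \<delta>" and w: "(\<Sum>p\<in>S. w p) = 0"
    and sep: "\<And>q q'. q \<in> S \<Longrightarrow> q' \<in> S \<Longrightarrow> q \<noteq> q' \<Longrightarrow> \<delta> \<le> eucl_dist d q q'"
  shows "\<delta> / (24 * gauss_const * sqrt d) * (\<Sum>p\<in>S. (w p)\<^sup>2)
    \<le> - (\<Sum>p\<in>S. \<Sum>q\<in>S. w p * w q * eucl_dist d p q)"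
proof -
  define T where "T = 3 * sqrt d / \<delta>"
  define W where "W = (\<Sum>p\<in>S. (w p)\<^sup>2)"
  define G where "G t = (\<Sum>p\<in>S. \<Sum>q\<in>S. w p * w q * exp (- (t\<^sup>2 * (eucl_dist d p q)\<^sup>2)))" for t
  have T: "0 < T" using d \<delta> by (simp add: T_def)
  have W: "0 \<le> W" by (simp add: W_def sum_nonneg)
  note hbi = has_bochner_integral_energy_form[OF w, of d, folded G_def]
  \<comment> \<open>The window from \<open>T\<close> to \<open>2 * T\<close> has length
    \<open>T\<close>, and on it the integrand is at least \<open>W / 2\<close> over the square of
    \<open>2 * T\<close>. The factor \<open>3\<close> in \<open>T\<close> gives
    \<open>9 * d\<close>, enough for the required \<open>5 * d\<close>, and turns \<open>8\<close>
    into \<open>24\<close>.\<close>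
  have "W / (8 * T) = (\<integral>t. indicator {T..2 * T} t * (1/2 * W / (2 * T)\<^sup>2) \<partial>lborel)"
    using T by (simp add: power2_eq_square)
  also have "\<dots> \<le> (\<integral>t. G t / t\<^sup>2 \<partial>lborel)"
  proof (rule integral_mono)
    show "integrable lborel (\<lambda>t. indicator {T..2 * T} t * (1/2 * W / (2 * T)\<^sup>2))"
      by (intro integrable_mult_left) (auto simp: integrable_indicator_iff emeasure_lborel_Icc_eq)
    show "integrable lborel (\<lambda>t. G t / t\<^sup>2)"
      using hbi by (rule integrable.intros)
    show "indicator {T..2 * T} t * (1/2 * W / (2 * T)\<^sup>2) \<le> G t / t\<^sup>2" for t
    proof (cases "t \<in> {T..2 * T}")
      case True
      then have "0 < t" "T \<le> t" "t \<le> 2 * T"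
        using T by auto
      then have t: "T\<^sup>2 \<le> t\<^sup>2" "t\<^sup>2 \<le> (2 * T)\<^sup>2" "0 < t\<^sup>2"
        using T by (intro power_mono zero_less_power; linarith)+
      have "5 * real d \<le> T\<^sup>2 * \<delta>\<^sup>2"
        using \<delta> by (simp add: T_def power_divide power_mult_distrib)
      also have "\<dots> \<le> t\<^sup>2 * \<delta>\<^sup>2"
        using t by (intro mult_right_mono) auto
      finally have "1/2 * W \<le> G t"
        unfolding W_def G_def using S d \<delta> sep by (intro gauss_form_ge_half) auto
      then have "1/2 * W / (2 * T)\<^sup>2 \<le> G t / t\<^sup>2"
        using t W by (intro frac_le) auto
      then show ?thesis using True by simp
    qed (simp add: G_def gauss_kernel_psd)
  qed
  also have "\<dots> = gauss_const * - (\<Sum>p\<in>S. \<Sum>q\<in>S. w p * w q * eucl_dist d p q)"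
    using hbi by (rule has_bochner_integral_integral_eq)
  finally have "W / (8 * T) / gauss_const \<le> - (\<Sum>p\<in>S. \<Sum>q\<in>S. w p * w q * eucl_dist d p q)"
    by (simp only: pos_divide_le_eq[OF gauss_const_pos] mult.commute)
  moreover have "W / (8 * T) / gauss_const = \<delta> / (24 * gauss_const * sqrt d) * W"
    using \<delta> d gauss_const_pos by (simp add: T_def field_simps)
  ultimately show ?thesis by (simp add: W_def)
qed

subsection \<open>Finitely supported distributions\<close>

text \<open>Formulated over an arbitrary type so that it also applies to the product spaces in the
  energy distance. Points of \<open>S\<close> may have mass \<open>0\<close>, which lets two
  measures share one set.\<close>

definition fin_supp_prob :: "'a measure \<Rightarrow> 'a set \<Rightarrow> bool" where
  "fin_supp_prob M S \<longleftrightarrow>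
     prob_space M \<and> finite S \<and> (\<forall>a\<in>S. {a} \<in> sets M) \<and> measure M S = 1"

lemma fin_supp_prob_sets:
  assumes "fin_supp_prob M S" "A \<subseteq> S"
  shows "A \<in> sets M"
proof -
  have "(\<Union>a\<in>A. {a}) \<in> sets M"
    using assms finite_subset by (intro sets.finite_UN) (auto simp: fin_supp_prob_def)
  then show ?thesis by simp
qed

lemma fin_supp_prob_measure:
  assumes M: "fin_supp_prob M S" and A: "A \<in> sets M"
  shows "measure M A = (\<Sum>a\<in>A \<inter> S. measure M {a})"
proof -
  interpret prob_space M using M by (simp add: fin_supp_prob_def)
  have S: "S \<in> sets M" using M by (rule fin_supp_prob_sets) simp
  have "AE x in M. x \<in> S"
    using M S by (simp add: AE_in_set_eq_1 fin_supp_prob_def)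
  then have "measure M A = measure M (A \<inter> S)"
    using A S by (intro finite_measure_eq_AE) auto
  also have "\<dots> = (\<Sum>a\<in>A \<inter> S. measure M {a})"
    using M by (intro finite_measure_eq_sum_singleton) (auto simp: fin_supp_prob_def)
  finally show ?thesis .
qed

lemma fin_supp_prob_sum:
  assumes M: "fin_supp_prob M S"
  shows "(\<Sum>a\<in>S. measure M {a}) = 1"
  using fin_supp_prob_measure[OF M fin_supp_prob_sets[OF M order_refl]] M
  by (simp add: fin_supp_prob_def)

lemma fin_supp_prob_integral:
  fixes f :: "'a \<Rightarrow> real"
  assumes M: "fin_supp_prob M S" and f: "f \<in> borel_measurable M"
  shows "(\<integral>x. f x \<partial>M) = (\<Sum>a\<in>S. measure M {a} * f a)"
proof -
  interpret prob_space M using M by (simp add: fin_supp_prob_def)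
  have S: "finite S" "\<And>a. a \<in> S \<Longrightarrow> {a} \<in> sets M" and supp: "AE x in M. x \<in> S"
    using M fin_supp_prob_sets[OF M order_refl] by (auto simp: AE_in_set_eq_1 fin_supp_prob_def)
  have "(\<integral>x. f x \<partial>M) = (\<integral>x. (\<Sum>a\<in>S. indicator {a} x * f a) \<partial>M)"
  proof (rule integral_cong_AE)
    have "f x = (\<Sum>a\<in>S. indicator {a} x * f a)" if "x \<in> S" for x
    proof -
      have "(\<Sum>a\<in>S. indicator {a} x * f a) = (\<Sum>a\<in>S. if x = a then f a else 0)"
        by (intro sum.cong) auto
      then show ?thesis using S(1) that by simp
    qed
    then show "AE x in M. f x = (\<Sum>a\<in>S. indicator {a} x * f a)"
      by (intro eventually_mono[OF supp])
    show "(\<lambda>x. \<Sum>a\<in>S. indicator {a} x * f a) \<in> borel_measurable M"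
      using S(2) by (intro borel_measurable_sum borel_measurable_times borel_measurable_indicator) auto
  qed (rule f)
  also have "\<dots> = (\<Sum>a\<in>S. (\<integral>x. indicator {a} x * f a \<partial>M))"
    using S(2) by (intro Bochner_Integration.integral_sum integrable_mult_left integrable_real_indicator)
       (auto simp: emeasure_eq_measure)
  also have "\<dots> = (\<Sum>a\<in>S. measure M {a} * f a)"
    using S(2) sets.sets_into_space by (intro sum.cong refl) (simp add: Int_absorb2)
  finally show ?thesis .
qed

text \<open>Applied three times, this turns the integral over the fourfold product into a finite
  sum.\<close>

lemma fin_supp_prob_pair:
  assumes M: "fin_supp_prob M S" and N: "fin_supp_prob N T"
  shows "fin_supp_prob (M \<Otimes>\<^sub>M N) (S \<times> T)"
    and "\<And>a b. a \<in> S \<Longrightarrow> b \<in> T \<Longrightarrow> measure (M \<Otimes>\<^sub>M N) {(a, b)} = measure M {a} * measure N {b}"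
proof -
  interpret M: prob_space M using M by (simp add: fin_supp_prob_def)
  interpret N: prob_space N using N by (simp add: fin_supp_prob_def)
  interpret pair_prob_space M N ..
  have times: "measure (M \<Otimes>\<^sub>M N) (A \<times> B) = measure M A * measure N B"
    if "A \<subseteq> S" "B \<subseteq> T" for A B
    using that M N by (simp add: fin_supp_prob_sets N.emeasure_pair_measure_Times measure_def enn2real_mult)
  show "measure (M \<Otimes>\<^sub>M N) {(a, b)} = measure M {a} * measure N {b}" if "a \<in> S" "b \<in> T" for a b
    using times[of "{a}" "{b}"] that by simp
  have "{(a, b)} \<in> sets (M \<Otimes>\<^sub>M N)" if "a \<in> S" "b \<in> T" for a b
    using pair_measureI[of "{a}" M "{b}" N] that M N by (simp add: fin_supp_prob_def)
  then show "fin_supp_prob (M \<Otimes>\<^sub>M N) (S \<times> T)"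
    unfolding fin_supp_prob_def using M N times[of S T]
    by (auto simp: fin_supp_prob_def prob_space_axioms)
qed

lemma fin_supp_prob_Rn:
  assumes \<mu>: "prob_on_Rn d \<mu>" and S: "finite S" "S \<subseteq> space (Rn d)" and supp: "supported_on \<mu> S"
  shows "fin_supp_prob \<mu> S"
proof -
  interpret prob_space \<mu> using \<mu> by (simp add: prob_on_Rn_def)
  have sing: "{a} \<in> sets \<mu>" if "a \<in> S" for a
  proof -
    have "a \<in> extensional {..<d}"
      using that S(2) by (auto simp: Rn_def space_PiM PiE_def)
    \<comment> \<open>Extensionality makes the singleton a box with one-point sides, hence
      measurable.\<close>
    then have "{a} = Pi\<^sub>E {..<d} (\<lambda>l. {a l})"
      by (simp add: PiE_singleton)
    also have "\<dots> \<in> sets (Rn d)"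
      unfolding Rn_def by (intro sets_PiM_I_finite) auto
    finally show ?thesis using \<mu> by (simp add: prob_on_Rn_def)
  qed
  have "(\<Union>a\<in>S. {a}) \<in> sets \<mu>"
    using S(1) sing by (intro sets.finite_UN) auto
  then have "measure \<mu> S = 1"
    using supp by (simp add: supported_on_def AE_in_set_eq_1)
  then show ?thesis
    using S(1) sing by (simp add: fin_supp_prob_def prob_space_axioms)
qed

section \<open>Energy distance and total variation in terms of point masses\<close>

lemma measurable_eucl_dist:
  assumes "f \<in> measurable M (Rn d)" "g \<in> measurable M (Rn d)"
  shows "(\<lambda>x. eucl_dist d (f x) (g x)) \<in> borel_measurable M"
proof -
  have "(\<lambda>x. f x l) \<in> borel_measurable M" "(\<lambda>x. g x l) \<in> borel_measurable M" if "l < d" for l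
    using assms that unfolding Rn_def by (auto intro: measurable_component_singleton[THEN measurable_compose[rotated]])
  then show ?thesis
    unfolding eucl_dist_def L2_set_def
    by (intro measurable_compose[OF _ borel_measurable_sqrt] borel_measurable_sum borel_measurable_power borel_measurable_diff) auto
qed

text \<open>In each of the three distances the two absent variables sum out with total mass
  \<open>1\<close>. The remaining double sums combine by bilinearity and symmetry of the
  distance.\<close>

lemma energy_dist_sq_eq:
  assumes \<mu>: "prob_on_Rn d \<mu>" "fin_supp_prob \<mu> S" and \<nu>: "prob_on_Rn d \<nu>" "fin_supp_prob \<nu> S"
  defines "w \<equiv> \<lambda>p. measure \<mu> {p} - measure \<nu> {p}"
  shows "energy_dist_sq d \<mu> \<nu> = - (\<Sum>p\<in>S. \<Sum>q\<in>S. w p * w q * eucl_dist d p q)"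
proof -
  define m where "m p = measure \<mu> {p}" for p
  define n where "n p = measure \<nu> {p}" for p
  define D where "D = eucl_dist d"
  have m1: "sum m S = 1" and n1: "sum n S = 1"
    using \<mu>(2) \<nu>(2) by (simp_all add: m_def n_def fin_supp_prob_sum)
  note nn = fin_supp_prob_pair[OF \<nu>(2) \<nu>(2)]
  note mnn = fin_supp_prob_pair[OF \<mu>(2) nn(1)]
  note mmnn = fin_supp_prob_pair[OF \<mu>(2) mnn(1)]
  let ?P = "\<mu> \<Otimes>\<^sub>M \<mu> \<Otimes>\<^sub>M \<nu> \<Otimes>\<^sub>M \<nu>"
  have [measurable_cong]: "sets \<mu> = sets (Rn d)" "sets \<nu> = sets (Rn d)"
    using \<mu> \<nu> by (simp_all add: prob_on_Rn_def)
  have meas: "(\<lambda>(X, X', Y, Y'). 2 * eucl_dist d X Y - eucl_dist d X X' - eucl_dist d Y Y')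
      \<in> borel_measurable ?P"
    unfolding split_beta
    by (intro borel_measurable_diff borel_measurable_times measurable_eucl_dist) measurable
  have "energy_dist_sq d \<mu> \<nu>
      = (\<Sum>z\<in>S \<times> S \<times> S \<times> S. measure ?P {z} *
          (case z of (X, X', Y, Y') \<Rightarrow> 2 * eucl_dist d X Y - eucl_dist d X X' - eucl_dist d Y Y'))"
    unfolding energy_dist_sq_def using mmnn(1) meas by (rule fin_supp_prob_integral)
  also have "\<dots> = (\<Sum>(a, b, c, e)\<in>S \<times> S \<times> S \<times> S.
      m a * (m b * (n c * n e)) * (2 * D a c - D a b - D c e))"
    by (intro sum.cong refl) (auto simp: mmnn(2) mnn(2) nn(2) m_def n_def D_def)
  also have "\<dots> = (\<Sum>a\<in>S. \<Sum>b\<in>S. \<Sum>c\<in>S. \<Sum>e\<in>S.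
      m a * (m b * (n c * n e)) * (2 * D a c - D a b - D c e))"
    by (simp add: sum.cartesian_product split_def)
  also have "\<dots> = 2 * (\<Sum>a\<in>S. \<Sum>c\<in>S. m a * n c * D a c)
      - (\<Sum>a\<in>S. \<Sum>b\<in>S. m a * m b * D a b) - (\<Sum>c\<in>S. \<Sum>e\<in>S. n c * n e * D c e)"
  proof -
    \<comment> \<open>Here \<open>v\<close> stands for a quantity independent of the fourth
      variable, as in the first two distances.\<close>
    have e: "(\<Sum>e\<in>S. m a * (m b * (n c * n e)) * v) = m b * (m a * n c * v)" for a b c v
    proof -
      have "(\<Sum>e\<in>S. m a * (m b * (n c * n e)) * v) = (\<Sum>e\<in>S. m b * (m a * n c * v) * n e)"
        by (intro sum.cong) auto
      also have "\<dots> = m b * (m a * n c * v)"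
        by (simp only: sum_distrib_left[symmetric] n1 mult_1_right)
      finally show ?thesis .
    qed
    have 1: "(\<Sum>a\<in>S. \<Sum>b\<in>S. \<Sum>c\<in>S. \<Sum>e\<in>S. m a * (m b * (n c * n e)) * (2 * D a c))
        = 2 * (\<Sum>a\<in>S. \<Sum>c\<in>S. m a * n c * D a c)"
    proof -
      have "(\<Sum>a\<in>S. \<Sum>b\<in>S. \<Sum>c\<in>S. \<Sum>e\<in>S. m a * (m b * (n c * n e)) * (2 * D a c))
          = (\<Sum>a\<in>S. \<Sum>c\<in>S. m a * n c * (2 * D a c))"
        unfolding e by (simp only: sum_distrib_left[symmetric] sum_distrib_right[symmetric] m1 mult_1)
      also have "\<dots> = 2 * (\<Sum>a\<in>S. \<Sum>c\<in>S. m a * n c * D a c)"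
        unfolding sum_distrib_left by (intro sum.cong) auto
      finally show ?thesis .
    qed
    have 2: "(\<Sum>a\<in>S. \<Sum>b\<in>S. \<Sum>c\<in>S. \<Sum>e\<in>S. m a * (m b * (n c * n e)) * D a b)
        = (\<Sum>a\<in>S. \<Sum>b\<in>S. m a * m b * D a b)"
    proof -
      have "(\<Sum>c\<in>S. m b * (m a * n c * D a b)) = (\<Sum>c\<in>S. m a * m b * D a b * n c)" for a b
        by (intro sum.cong) auto
      then show ?thesis
        unfolding e by (simp only: sum_distrib_left[symmetric] n1 mult_1_right)
    qed
    have 3: "(\<Sum>a\<in>S. \<Sum>b\<in>S. \<Sum>c\<in>S. \<Sum>e\<in>S. m a * (m b * (n c * n e)) * D c e)
        = (\<Sum>c\<in>S. \<Sum>e\<in>S. n c * n e * D c e)"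
    proof -
      have "(\<Sum>c\<in>S. \<Sum>e\<in>S. m a * (m b * (n c * n e)) * D c e)
          = m a * (m b * (\<Sum>c\<in>S. \<Sum>e\<in>S. n c * n e * D c e))" for a b
        unfolding sum_distrib_left by (intro sum.cong) auto
      then show ?thesis
        by (simp only: sum_distrib_left[symmetric] sum_distrib_right[symmetric] m1 mult_1)
    qed
    show ?thesis
      unfolding right_diff_distrib sum_subtractf 1 2 3 ..
  qed
  also have "\<dots> = - (\<Sum>p\<in>S. \<Sum>q\<in>S. w p * w q * eucl_dist d p q)"
  proof -
    have "(\<Sum>a\<in>S. \<Sum>c\<in>S. n a * m c * D a c) = (\<Sum>c\<in>S. \<Sum>a\<in>S. n a * m c * D a c)"
      by (rule sum.swap)
    also have "\<dots> = (\<Sum>a\<in>S. \<Sum>c\<in>S. m a * n c * D a c)"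
      by (intro sum.cong refl) (simp add: D_def eucl_dist_commute mult_ac)
    finally have "(\<Sum>a\<in>S. \<Sum>c\<in>S. n a * m c * D a c) = (\<Sum>a\<in>S. \<Sum>c\<in>S. m a * n c * D a c)" .
    moreover have "(\<Sum>p\<in>S. \<Sum>q\<in>S. w p * w q * eucl_dist d p q)
      = (\<Sum>p\<in>S. \<Sum>q\<in>S. m p * m q * D p q) - (\<Sum>p\<in>S. \<Sum>q\<in>S. m p * n q * D p q)
        - (\<Sum>p\<in>S. \<Sum>q\<in>S. n p * m q * D p q) + (\<Sum>p\<in>S. \<Sum>q\<in>S. n p * n q * D p q)"
      unfolding sum_subtractf[symmetric] sum.distrib[symmetric]
      by (intro sum.cong refl) (simp add: w_def m_def n_def D_def algebra_simps)
    ultimately show ?thesis by simp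
  qed
  finally show ?thesis .
qed

text \<open>The empty set gives the lower bound, needed for squaring the upper one. The sum is twice
  the total variation; this loss only affects the constant.\<close>

lemma TV_le_sum:
  assumes \<mu>: "fin_supp_prob \<mu> S" and \<nu>: "fin_supp_prob \<nu> S" and sets: "sets \<mu> = sets \<nu>"
  shows "0 \<le> TV \<mu> \<nu>" and "TV \<mu> \<nu> \<le> (\<Sum>p\<in>S. \<bar>measure \<mu> {p} - measure \<nu> {p}\<bar>)"
proof -
  have le: "measure \<mu> A - measure \<nu> A \<le> (\<Sum>p\<in>S. \<bar>measure \<mu> {p} - measure \<nu> {p}\<bar>)"
    if "A \<in> sets \<mu>" for A
  proof -
    have "measure \<mu> A - measure \<nu> A = (\<Sum>p\<in>A \<inter> S. measure \<mu> {p} - measure \<nu> {p})"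
      using that sets \<mu> \<nu> by (simp add: fin_supp_prob_measure sum_subtractf)
    also have "\<dots> \<le> (\<Sum>p\<in>A \<inter> S. \<bar>measure \<mu> {p} - measure \<nu> {p}\<bar>)"
      by (intro sum_mono) auto
    also have "\<dots> \<le> (\<Sum>p\<in>S. \<bar>measure \<mu> {p} - measure \<nu> {p}\<bar>)"
      using \<mu> by (intro sum_mono2) (auto simp: fin_supp_prob_def)
    finally show ?thesis .
  qed
  then show "TV \<mu> \<nu> \<le> (\<Sum>p\<in>S. \<bar>measure \<mu> {p} - measure \<nu> {p}\<bar>)"
    unfolding TV_def by (intro cSUP_least) auto
  have "measure \<mu> {} - measure \<nu> {} \<le> TV \<mu> \<nu>"
    unfolding TV_def using le by (intro cSUP_upper bdd_aboveI2) auto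
  then show "0 \<le> TV \<mu> \<nu>" by simp
qed

section \<open>Minimal separation and the final estimate\<close>

lemma min_separation_le:
  assumes "i \<in> {1..k}" "j \<in> {1..k}" "i \<noteq> j"
  shows "min_separation d k x \<le> eucl_dist d (x i) (x j)"
proof -
  have "finite ((\<lambda>(i, j). eucl_dist d (x i) (x j)) ` ({1..k} \<times> {1..k}))"
    by simp
  then have "finite {eucl_dist d (x i) (x j) | i j. i \<in> {1..k} \<and> j \<in> {1..k} \<and> i \<noteq> j}"
    by (rule finite_subset[rotated]) auto
  then show ?thesis
    unfolding min_separation_def using assms by (intro Min_le) auto
qed

theorem theorem6:
  "\<exists>C::real. C > 0 \<and>
     (\<forall>(k::nat) (d::nat) (x :: nat \<Rightarrow> nat \<Rightarrow> real)
       (\<mu> :: (nat \<Rightarrow> real) measure) (\<nu> :: (nat \<Rightarrow> real) measure).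
        k \<ge> 2 \<longrightarrow> d \<ge> 1 \<longrightarrow>
        x ` {1..k} \<subseteq> space (Rn d) \<longrightarrow>
        prob_on_Rn d \<mu> \<longrightarrow> prob_on_Rn d \<nu> \<longrightarrow>
        supported_on \<mu> (x ` {1..k}) \<longrightarrow> supported_on \<nu> (x ` {1..k}) \<longrightarrow>
        energy_dist_sq d \<mu> \<nu> \<ge>
          C * min_separation d k x / (real k * sqrt (real d)) * (TV \<mu> \<nu>)\<^sup>2)"
proof (intro exI[of _ "1 / (24 * gauss_const)"] conjI allI impI)
  show "0 < 1 / (24 * gauss_const)"
    using gauss_const_pos by simp
next
  fix k d :: nat and x \<mu> \<nu>
  assume k: "2 \<le> k" and d: "1 \<le> d" and x: "x ` {1..k} \<subseteq> space (Rn d)"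
    and \<mu>: "prob_on_Rn d \<mu>" and \<nu>: "prob_on_Rn d \<nu>"
    and supp: "supported_on \<mu> (x ` {1..k})" "supported_on \<nu> (x ` {1..k})"
  define S where "S = x ` {1..k}"
  define w where "w p = measure \<mu> {p} - measure \<nu> {p}" for p
  define \<delta> where "\<delta> = min_separation d k x"
  have fs: "fin_supp_prob \<mu> S" "fin_supp_prob \<nu> S"
    using fin_supp_prob_Rn[OF \<mu> _ _ supp(1)] fin_supp_prob_Rn[OF \<nu> _ _ supp(2)] x
    by (simp_all add: S_def)
  have S: "finite S" "card S \<le> k"
    using card_image_le[of "{1..k}" x] by (auto simp: S_def)
  have w0: "(\<Sum>p\<in>S. w p) = 0"
    using fs by (simp add: w_def sum_subtractf fin_supp_prob_sum)
  have E: "energy_dist_sq d \<mu> \<nu> = - (\<Sum>p\<in>S. \<Sum>q\<in>S. w p * w q * eucl_dist d p q)"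
    unfolding w_def using \<mu> fs(1) \<nu> fs(2) by (rule energy_dist_sq_eq)
  show "1 / (24 * gauss_const) * min_separation d k x / (real k * sqrt (real d)) * (TV \<mu> \<nu>)\<^sup>2
      \<le> energy_dist_sq d \<mu> \<nu>"
  \<comment> \<open>If points are repeated, the separation vanishes and the bound reduces to
    nonnegativity of the energy form.\<close>
  proof (cases "0 < \<delta>")
    case True
    have sep: "\<delta> \<le> eucl_dist d p q" if "p \<in> S" "q \<in> S" "p \<noteq> q" for p q
      using that unfolding S_def \<delta>_def by (auto intro: min_separation_le)
    have "(TV \<mu> \<nu>)\<^sup>2 \<le> (\<Sum>p\<in>S. \<bar>w p\<bar>)\<^sup>2"
      unfolding w_def using TV_le_sum[OF fs] \<mu> \<nu> by (intro power_mono) (auto simp: prob_on_Rn_def)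
    \<comment> \<open>Cauchy--Schwarz against the constant function \<open>1\<close> brings in the
      number of points.\<close>
    also have "\<dots> \<le> (\<Sum>p\<in>S. \<bar>w p\<bar>\<^sup>2) * card S"
      using Cauchy_Schwarz_ineq_sum[of "\<lambda>p. \<bar>w p\<bar>" "\<lambda>_. 1" S] by simp
    also have "\<dots> \<le> (\<Sum>p\<in>S. \<bar>w p\<bar>\<^sup>2) * k"
      using S(2) by (intro mult_left_mono sum_nonneg) auto
    finally have tv: "(TV \<mu> \<nu>)\<^sup>2 \<le> (\<Sum>p\<in>S. (w p)\<^sup>2) * k" by simp
    have "1 / (24 * gauss_const) * \<delta> / (real k * sqrt (real d)) * (TV \<mu> \<nu>)\<^sup>2
        \<le> 1 / (24 * gauss_const) * \<delta> / (real k * sqrt (real d)) * ((\<Sum>p\<in>S. (w p)\<^sup>2) * k)"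
      using tv True gauss_const_pos by (intro mult_left_mono) auto
    also have "\<dots> = \<delta> / (24 * gauss_const * sqrt d) * (\<Sum>p\<in>S. (w p)\<^sup>2)"
      using k by simp
    also have "\<dots> \<le> energy_dist_sq d \<mu> \<nu>"
      unfolding E using S(1) d True w0 sep by (rule energy_form_ge)
    finally show ?thesis by (simp add: \<delta>_def)
  next
    case False
    then have "1 / (24 * gauss_const) * \<delta> / (real k * sqrt (real d)) * (TV \<mu> \<nu>)\<^sup>2 \<le> 0"
      using gauss_const_pos
      by (intro mult_nonpos_nonneg divide_nonpos_nonneg mult_nonneg_nonpos) auto
    also have "0 \<le> energy_dist_sq d \<mu> \<nu>"
      unfolding E using w0 by (rule energy_form_nonneg)
    finally show ?thesis by (simp add: \<delta>_def)
  qed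
qed

end
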